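(* Let $G=(V,E)$ be a locally finite connected simple graph with Bernoulli bond percolation in which each edge $e\in E$ is open with probability $p_e\in[0,1]$, independently of the other edges. Let $a,b,c$ be distinct vertices of $G$. Then $$\mathbf{P}(abc)^2\le 8\,\mathbf{P}(ab)\,\mathbf{P}(ac)\,\mathbf{P}(bc).$$
   Context: A percolation configuration is an element of $\{0,1\}^E$ (1 = open, 0 = closed); $\mathbf{P}$ is the product measure in which edge $e$ is open with probability $p_e$. Clusters are the connected components of the subgraph $(V,\{\text{open edges}\})$. $\mathbf{P}(abc)$ is the probability that $a,b,c$ are all in the same cluster, and $\mathbf{P}(uv)$ is the probability that the vertices $u,v$ are in the same cluster. *)

theory Defs
  imports "HOL-Probability.Probability"
begin

text \<open>Edges are two-element sets of vertices. The vertex set may be infinite.\<close>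

definition simple_graph :: "'a set \<Rightarrow> 'a set set \<Rightarrow> bool" where
  "simple_graph V E \<longleftrightarrow> (\<forall>e\<in>E. e \<subseteq> V \<and> card e = 2)"

definition locally_finite_graph :: "'a set \<Rightarrow> 'a set set \<Rightarrow> bool" where
  "locally_finite_graph V E \<longleftrightarrow> (\<forall>v\<in>V. finite {e \<in> E. v \<in> e})"

definition joined :: "'a set \<Rightarrow> 'a set set \<Rightarrow> 'a rel" where
  "joined V F = {(u, v). u \<in> V \<and> v \<in> V \<and> (u, v) \<in> {(x, y). {x, y} \<in> F}\<^sup>*}"

definition connected_components :: "'a set \<Rightarrow> 'a set set \<Rightarrow> 'a set set" where
  "connected_components V F = V // joined V F"

definition connected_graph :: "'a set \<Rightarrow> 'a set set \<Rightarrow> bool" where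
  "connected_graph V E \<longleftrightarrow> (\<forall>u\<in>V. \<forall>v\<in>V. (u, v) \<in> joined V E)"

text \<open>Configurations are the functions in \<open>E \<rightarrow>\<^sub>E UNIV\<close>, with \<^const>\<open>True\<close> for an open edge.\<close>

definition percolation :: "'a set set \<Rightarrow> ('a set \<Rightarrow> real) \<Rightarrow> ('a set \<Rightarrow> bool) measure" where
  "percolation E p = (\<Pi>\<^sub>M e\<in>E. measure_pmf (bernoulli_pmf (p e)))"

definition clusters :: "'a set \<Rightarrow> 'a set set \<Rightarrow> ('a set \<Rightarrow> bool) \<Rightarrow> 'a set set" where
  "clusters V E \<omega> = connected_components V {e \<in> E. \<omega> e}"

text \<open>A connected locally finite graph is countable, so the event below is measurable for it; otherwise
  the value could be the default \<open>0\<close> of \<^const>\<open>measure\<close>.\<close>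

definition same_cluster_prob ::
    "'a set \<Rightarrow> 'a set set \<Rightarrow> ('a set \<Rightarrow> real) \<Rightarrow> 'a set \<Rightarrow> real" where
  "same_cluster_prob V E p S = \<P>(\<omega> in percolation E p. \<exists>C\<in>clusters V E \<omega>. S \<subseteq> C)"

end

theory Submission
  imports Defs
begin

text \<open>
  Let \<open>E\<close> be finite and explore the cluster of \<open>a\<close> depth first: at the tip of the current walk
  query an unexplored edge, cross it if it is open, and backtrack once the tip has no unexplored
  edge left. If \<open>a\<close>, \<open>b\<close>, \<open>c\<close> are in one cluster, the tip arrives at \<open>b\<close> or at \<open>c\<close>; stop at the first
  arrival. Suppose that it is at \<open>b\<close>. All vertices that the walk has abandoned are exhausted, so \<open>c\<close>
  is in the cluster only if \<open>c\<close> is connected to a vertex of the current walk by open unexplored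
  edges; let \<open>q\<close> be the conditional probability of this. By Cauchy-Schwarz
  \<open>P(abc, b first)\<^sup>2 = (E[1\<^bsub>b first\<^esub> q])\<^sup>2 \<le> P(ab) E[1\<^bsub>b first\<^esub> q\<^sup>2]\<close>.

  Here \<open>q\<^sup>2\<close> is the probability that in two independent copies \<open>F\<close>, \<open>G\<close> of the unexplored edges \<open>c\<close> is
  connected to the walk, say at \<open>z\<close> in \<open>F\<close> and at \<open>x\<close> in \<open>G\<close>. At the cost of a factor \<open>2\<close>, \<open>z\<close> does
  not come after \<open>x\<close> on the way from \<open>a\<close> to \<open>b\<close>. Then the part of the walk before \<open>z\<close> together with \<open>F\<close> connects
  \<open>a\<close> to \<open>c\<close>, and the part after \<open>z\<close> together with \<open>G\<close> connects \<open>b\<close> to \<open>c\<close>. No explored edge serves both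
  connections, so an argument of van den Berg-Kesten type gives the bound
  \<open>E[1\<^bsub>b first\<^esub> q\<^sup>2] \<le> 2 P(ac) P(bc)\<close>. With the same bound for \<open>c\<close> first,
  \<open>P(abc) \<le> 2 sqrt (2 P(ab) P(ac) P(bc))\<close>, and squaring gives the constant \<open>8\<close>.

  In place of a decision tree, the proof uses an invariant. A state consists of the walk and the set
  of unexplored edges, and \<open>exploration_inequality\<close> is a statement about every state, proved by
  induction backwards from the final states. The step that queries an edge rests on
  \<open>splits_query\<close>, the edge-wise van den Berg-Kesten inequality, and on \<open>sqrt_mix_le\<close>, the edge-wise
  Cauchy-Schwarz inequality; the final states are treated by \<open>exploration_at_target\<close>, where the factor
  \<open>2\<close> arises. An infinite locally finite connected graph has countably many edges, and the
  probabilities are limits along an increasing sequence of finite edge sets.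
\<close>

section \<open>Connection by open edges\<close>

definition linked :: "'a set set \<Rightarrow> 'a \<Rightarrow> 'a \<Rightarrow> bool" where
  "linked F u v \<longleftrightarrow> (u, v) \<in> {(x, y). {x, y} \<in> F}\<^sup>*"

definition reaches :: "'a set \<Rightarrow> 'a \<Rightarrow> 'a set set \<Rightarrow> bool" where
  "reaches S v F \<longleftrightarrow> (\<exists>x\<in>S. linked F x v)"

lemma linked_refl [simp]: "linked F u u"
  by (simp add: linked_def)

lemma linked_trans [trans]: "linked F u v \<Longrightarrow> linked F v w \<Longrightarrow> linked F u w"
  by (simp add: linked_def)

lemma linked_sym: "linked F u v \<Longrightarrow> linked F v u"
proof -
  have "sym {(x, y). {x, y} \<in> F}"
    by (auto simp: sym_def insert_commute)
  then show "linked F u v \<Longrightarrow> linked F v u"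
    unfolding linked_def by (meson sym_rtrancl symD)
qed

lemma linked_mono: "linked F u v \<Longrightarrow> F \<subseteq> G \<Longrightarrow> linked G u v"
  unfolding linked_def
  by (erule rtrancl_mono[THEN subsetD, rotated]) auto

lemma linked_edge: "{u, v} \<in> F \<Longrightarrow> linked F u v"
  by (auto simp: linked_def)

text \<open>After its last visit to \<open>x\<close> or \<open>y\<close>, a path no longer uses the edge between them.\<close>

lemma linked_insert_cases:
  assumes "linked (insert {x, y} F) z v"
  shows "linked F z v \<or> linked F x v \<or> linked F y v"
  using assms unfolding linked_def
proof (induction rule: converse_rtrancl_induct)
  case (step u w)
  then have "{u, w} \<in> F \<or> u = x \<or> u = y"
    by (auto simp: doubleton_eq_iff)
  with step show ?case
    by (auto intro: converse_rtrancl_into_rtrancl simp: doubleton_eq_iff)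
qed simp

lemma linked_isolated:
  assumes "linked F x v" "\<And>e. e \<in> F \<Longrightarrow> x \<notin> e"
  shows "v = x"
  using assms unfolding linked_def by (metis (mono_tags, lifting) case_prodD converse_rtranclE insertI1 mem_Collect_eq)

text \<open>A connection is witnessed by the finitely many edges of a path; this makes connection
  probabilities on an infinite graph limits of those on finite subgraphs.\<close>

lemma linked_finite_subset:
  assumes "linked F u v"
  shows "\<exists>D. finite D \<and> D \<subseteq> F \<and> linked D u v"
  using assms unfolding linked_def
proof (induction rule: rtrancl_induct)
  case base
  then show ?case by (intro exI[of _ "{}"]) auto
next
  case (step y z)
  then obtain D where D: "finite D" "D \<subseteq> F" "linked D u y"
    by (auto simp: linked_def)
  have "linked (insert {y, z} D) u z"
    using linked_mono[OF D(3)] linked_edge[of y z "insert {y, z} D"]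
    by (meson insertI1 linked_trans subset_insertI)
  then show ?case
    using D step by (intro exI[of _ "insert {y, z} D"]) (auto simp: linked_def)
qed

section \<open>Expectation over finitely many independent edges\<close>

text \<open>A configuration is represented by its set \<open>F\<close> of open edges.\<close>

definition expect :: "('e \<Rightarrow> real) \<Rightarrow> 'e set \<Rightarrow> ('e set \<Rightarrow> real) \<Rightarrow> real" where
  "expect p R f = (\<Sum>F\<in>Pow R. (\<Prod>e\<in>F. p e) * (\<Prod>e\<in>R - F. 1 - p e) * f F)"

abbreviation prob_open :: "('e \<Rightarrow> real) \<Rightarrow> 'e set \<Rightarrow> ('e set \<Rightarrow> bool) \<Rightarrow> real" where
  "prob_open p R Q \<equiv> expect p R (\<lambda>F. of_bool (Q F))"

abbreviation prob_open2 ::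
    "('e \<Rightarrow> real) \<Rightarrow> 'e set \<Rightarrow> ('e set \<Rightarrow> 'e set \<Rightarrow> bool) \<Rightarrow> real" where
  "prob_open2 p R Q \<equiv> expect p R (\<lambda>F. expect p R (\<lambda>G. of_bool (Q F G)))"

text \<open>Conditioning on the state of the single edge \<open>e\<close>.\<close>

lemma expect_insert:
  assumes "finite R" "e \<notin> R"
  shows "expect p (insert e R) f =
    p e * expect p R (\<lambda>F. f (insert e F)) + (1 - p e) * expect p R f"
proof -
  have inj: "inj_on (insert e) (Pow R)"
    using assms by (auto simp: inj_on_def)
  have disj: "Pow R \<inter> insert e ` Pow R = {}"
    using assms by auto
  have open_part: "(\<Prod>e\<in>insert e F. p e) * (\<Prod>e\<in>insert e R - insert e F. 1 - p e) * f (insert e F)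
      = p e * ((\<Prod>e\<in>F. p e) * (\<Prod>e\<in>R - F. 1 - p e) * f (insert e F))"
    if "F \<in> Pow R" for F
  proof -
    have "insert e R - insert e F = R - F" "finite F" "e \<notin> F"
      using that assms by (auto intro: finite_subset)
    then show ?thesis by simp
  qed
  have closed_part: "(\<Prod>e\<in>F. p e) * (\<Prod>e\<in>insert e R - F. 1 - p e) * f F
      = (1 - p e) * ((\<Prod>e\<in>F. p e) * (\<Prod>e\<in>R - F. 1 - p e) * f F)"
    if "F \<in> Pow R" for F
  proof -
    have "insert e R - F = insert e (R - F)" "finite (R - F)" "e \<notin> R - F"
      using that assms by auto
    then show ?thesis by simp
  qed
  have "expect p (insert e R) f =
      (\<Sum>F\<in>Pow R. (\<Prod>e\<in>F. p e) * (\<Prod>e\<in>insert e R - F. 1 - p e) * f F)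
      + (\<Sum>F\<in>insert e ` Pow R. (\<Prod>e\<in>F. p e) * (\<Prod>e\<in>insert e R - F. 1 - p e) * f F)"
    unfolding expect_def Pow_insert using assms(1) disj by (intro sum.union_disjoint) auto
  also have "\<dots> = (1 - p e) * expect p R f + p e * expect p R (\<lambda>F. f (insert e F))"
    unfolding expect_def sum_distrib_left sum.reindex[OF inj] comp_def
    by (intro arg_cong2[where f = "(+)"] sum.cong refl closed_part open_part)
  finally show ?thesis by simp
qed

lemma expect_empty [simp]: "expect p {} f = f {}"
  by (simp add: expect_def)

lemma expect_const: "finite R \<Longrightarrow> expect p R (\<lambda>_. k) = k"
  by (induction R rule: finite_induct) (auto simp: expect_insert algebra_simps)

lemma expect_add: "expect p R (\<lambda>F. f F + g F) = expect p R f + expect p R g"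
  by (simp add: expect_def distrib_left sum.distrib)

lemma expect_cmult: "expect p R (\<lambda>F. k * f F) = k * expect p R f"
  by (simp add: expect_def sum_distrib_left mult_ac)

lemma expect_mult_right: "expect p R (\<lambda>F. f F * k) = expect p R f * k"
  using expect_cmult[of p R k f] by (simp add: mult.commute)

lemma expect_mono:
  assumes "\<And>e. e \<in> R \<Longrightarrow> 0 \<le> p e \<and> p e \<le> 1" "\<And>F. F \<subseteq> R \<Longrightarrow> f F \<le> g F"
  shows "expect p R f \<le> expect p R g"
  unfolding expect_def using assms
  by (intro sum_mono mult_left_mono mult_nonneg_nonneg prod_nonneg) auto

lemma expect_nonneg:
  assumes "\<And>e. e \<in> R \<Longrightarrow> 0 \<le> p e \<and> p e \<le> 1" "\<And>F. F \<subseteq> R \<Longrightarrow> 0 \<le> f F"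
  shows "0 \<le> expect p R f"
  using expect_mono[OF assms(1), where f = "\<lambda>_. 0" and g = f] assms(2)
  by (simp add: expect_def)

lemma expect_swap:
  "expect p R (\<lambda>F. expect p R (\<lambda>G. f F G)) = expect p R (\<lambda>G. expect p R (\<lambda>F. f F G))"
  unfolding expect_def sum_distrib_left
  by (subst sum.swap) (simp add: mult_ac)

lemma expect_prod:
  "expect p R (\<lambda>F. expect p R (\<lambda>G. f F * g G)) = expect p R f * expect p R g"
  by (simp add: expect_cmult expect_mult_right)

section \<open>Splitting the explored walk\<close>

text \<open>
  The walk \<open>xs\<close> is listed from its tip back to its starting vertex, so that \<open>ys @ [z]\<close> is the part of
  the walk from \<open>z\<close> to the tip. The vertex \<open>z\<close> splits the walk into a part that helps \<open>F\<close> to connect the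
  starting vertex to \<open>c\<close> and a part that helps \<open>G\<close> to connect \<open>b\<close> to \<open>c\<close>. As the edges of the walk are
  open, helping \<open>G\<close> means that all vertices of \<open>ys @ [z]\<close> count as one; this avoids
  having to record the edges of the walk.
\<close>

definition splits :: "'a \<Rightarrow> 'a \<Rightarrow> 'a list \<Rightarrow> 'a set set \<Rightarrow> 'a set set \<Rightarrow> bool" where
  "splits b c xs F G \<longleftrightarrow> (\<exists>ys z zs. xs = ys @ z # zs \<and> linked F z c \<and>
     (linked G b c \<or> reaches (set (ys @ [z])) b G \<and> reaches (set (ys @ [z])) c G))"

lemma reaches_mono: "reaches S v F \<Longrightarrow> S \<subseteq> T \<Longrightarrow> F \<subseteq> G \<Longrightarrow> reaches T v G"
  unfolding reaches_def by (meson linked_mono subsetD)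

lemma splits_mono:
  assumes "splits b c xs F G" "F \<subseteq> F'" "G \<subseteq> G'"
  shows "splits b c xs F' G'"
proof -
  obtain ys z zs where "xs = ys @ z # zs" "linked F z c"
    "linked G b c \<or> reaches (set (ys @ [z])) b G \<and> reaches (set (ys @ [z])) c G"
    using assms(1) by (auto simp: splits_def)
  then show ?thesis
    unfolding splits_def using assms(2,3)
    by (intro exI[of _ ys] exI[of _ z] exI[of _ zs]) (meson linked_mono reaches_mono order_refl)
qed

lemma splits_Cons: "splits b c xs F G \<Longrightarrow> splits b c (x # xs) F G"
proof -
  assume "splits b c xs F G"
  then obtain ys z zs where "xs = ys @ z # zs" "linked F z c"
    "linked G b c \<or> reaches (set (ys @ [z])) b G \<and> reaches (set (ys @ [z])) c G"
    by (auto simp: splits_def)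
  then show ?thesis
    unfolding splits_def
    by (intro exI[of _ "x # ys"] exI[of _ z] exI[of _ zs]) (auto simp: reaches_def)
qed

lemma reaches_insert_edge:
  assumes "reaches (insert y S) v F" "x \<in> S"
  shows "reaches S v (insert {x, y} F)"
proof -
  have "linked (insert {x, y} F) x y"
    by (simp add: linked_edge)
  then show ?thesis
    using assms unfolding reaches_def
    by (metis insertE linked_mono linked_trans subset_insertI)
qed

lemma reaches_contract_edge:
  assumes "reaches S v (insert {x, y} F)" "x \<in> S"
  shows "reaches (insert y S) v F"
  using assms linked_insert_cases unfolding reaches_def by (metis insert_iff)

text \<open>Crossing the edge from the tip \<open>x\<close> to \<open>y\<close> shares it between the two connections, but only one
  of them can make use of it: if the splitting vertex is the new tip \<open>y\<close>, the edge belongs to the part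
  on the side of \<open>F\<close>, and otherwise to the part on the side of \<open>G\<close>.\<close>

lemma splits_contract_edge:
  assumes "splits b c (y # x # xs) F G"
  shows "splits b c (x # xs) (insert {x, y} F) G \<or> splits b c (x # xs) F (insert {x, y} G)"
proof -
  obtain ys z zs where dec: "y # x # xs = ys @ z # zs" and F: "linked F z c"
    and G: "linked G b c \<or> reaches (set (ys @ [z])) b G \<and> reaches (set (ys @ [z])) c G"
    using assms by (auto simp: splits_def)
  show ?thesis
  proof (cases ys)
    case Nil
    (* A one-vertex part of the walk connects nothing new, so G does the work alone. *)
    with dec G have "z = y" and bc: "linked G b c"
      by (auto simp: reaches_def intro: linked_sym linked_trans)
    with F have "linked (insert {x, y} F) x c"
      by (meson insertI1 linked_edge linked_mono linked_trans subset_insertI)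
    with bc have "splits b c (x # xs) (insert {x, y} F) G"
      unfolding splits_def by (metis append_Nil)
    then show ?thesis ..
  next
    case (Cons y' us)
    with dec have dec': "x # xs = us @ z # zs" and "ys = y # us"
      by auto
    then have x: "x \<in> set (us @ [z])"
      by (cases us) auto
    have "set (ys @ [z]) = insert y (set (us @ [z]))"
      using \<open>ys = y # us\<close> by simp
    with G x have "linked (insert {x, y} G) b c \<or>
      reaches (set (us @ [z])) b (insert {x, y} G) \<and> reaches (set (us @ [z])) c (insert {x, y} G)"
      by (metis linked_mono reaches_insert_edge subset_insertI)
    with dec' F have "splits b c (x # xs) F (insert {x, y} G)"
      unfolding splits_def by blast
    then show ?thesis ..
  qed
qed

text \<open>Once the tip is \<open>b\<close>, the positions at which \<open>c\<close> is attached to the walk in \<open>F\<close> and in \<open>G\<close> can be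
  compared: the copy in which \<open>c\<close> is attached farther from the tip takes the role of the first
  configuration, and the splitting vertex is its point of attachment.\<close>

lemma splits_at_target:
  assumes "reaches (set (b # xs)) c F" "reaches (set (b # xs)) c G"
  shows "splits b c (b # xs) F G \<or> splits b c (b # xs) G F"
proof -
  obtain i j where i: "i < length (b # xs)" "linked F ((b # xs) ! i) c"
    and j: "j < length (b # xs)" "linked G ((b # xs) ! j) c"
    using assms unfolding reaches_def by (metis in_set_conv_nth)
  have *: "splits b c (b # xs) F G"
    if "i < length (b # xs)" "linked F ((b # xs) ! i) c" "linked G ((b # xs) ! j) c" "j \<le> i"
    for F G i j
  proof -
    let ?ys = "take i (b # xs)" and ?z = "(b # xs) ! i"
    have dec: "b # xs = ?ys @ ?z # drop (Suc i) (b # xs)"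
      using that(1) by (rule id_take_nth_drop)
    have pre: "?ys @ [?z] = take (Suc i) (b # xs)"
      using that(1) by (rule take_Suc_conv_app_nth[symmetric])
    have "b \<in> set (?ys @ [?z])"
      unfolding pre by simp
    moreover have "(b # xs) ! j \<in> set (?ys @ [?z])"
      unfolding pre using that(1,4) unfolding in_set_conv_nth
      by (intro exI[of _ j]) (auto simp del: take_Suc_Cons)
    ultimately have "reaches (set (?ys @ [?z])) b G \<and> reaches (set (?ys @ [?z])) c G"
      unfolding reaches_def using that(3) linked_refl by metis
    then show ?thesis
      unfolding splits_def using dec that(2) by blast
  qed
  show ?thesis
    using *[OF i j(2)] *[OF j i(2)] by linarith
qed

section \<open>The exploration inequality\<close>

text \<open>The Cauchy-Schwarz inequality for a Bernoulli variable. It makes a bound of the form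
  \<open>sqrt (u * w)\<close> pass from the two outcomes of a query to the state before it.\<close>

lemma sqrt_mix_le:
  fixes q u u' w w' :: real
  assumes "0 \<le> q" "q \<le> 1" "0 \<le> u" "0 \<le> u'" "0 \<le> w" "0 \<le> w'"
  shows "q * sqrt (u * w) + (1 - q) * sqrt (u' * w')
    \<le> sqrt ((q * u + (1 - q) * u') * (q * w + (1 - q) * w'))"
proof (rule real_le_rsqrt)
  let ?s = "sqrt (u * w')" and ?t = "sqrt (u' * w)"
  have "sqrt (u * w) * sqrt (u' * w') = ?s * ?t"
    by (simp add: real_sqrt_mult[symmetric] mult_ac)
  moreover have "2 * (?s * ?t) \<le> ?s\<^sup>2 + ?t\<^sup>2"
    using sum_squares_bound[of ?s ?t] by simp
  ultimately have am: "2 * (sqrt (u * w) * sqrt (u' * w')) \<le> u * w' + u' * w"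
    using assms by simp
  have "(q * sqrt (u * w) + (1 - q) * sqrt (u' * w'))\<^sup>2
    = q\<^sup>2 * (sqrt (u * w))\<^sup>2 + (1 - q)\<^sup>2 * (sqrt (u' * w'))\<^sup>2
      + q * (1 - q) * (2 * (sqrt (u * w) * sqrt (u' * w')))"
    by (simp add: power2_eq_square algebra_simps)
  also have "\<dots> \<le> q\<^sup>2 * (u * w) + (1 - q)\<^sup>2 * (u' * w') + q * (1 - q) * (u * w' + u' * w)"
    using assms mult_left_mono[OF am, of "q * (1 - q)"] by simp
  also have "\<dots> = (q * u + (1 - q) * u') * (q * w + (1 - q) * w')"
    by (simp add: power2_eq_square algebra_simps)
  finally show "(q * sqrt (u * w) + (1 - q) * sqrt (u' * w'))\<^sup>2
    \<le> (q * u + (1 - q) * u') * (q * w + (1 - q) * w')" .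
qed

text \<open>
  The probability of splitting does not increase in the mean when the exploration queries an edge. On
  the left the edge has one common state in \<open>F\<close> and \<open>G\<close>, on the right it has independent states.
  Fix the states of the other edges and suppose that the walk does not split when the edge is closed in both copies. The left side
  is then at most the probability \<open>q\<close> that the edge is open, and by \<open>splits_contract_edge\<close> it is positive
  only if the edge makes the walk split through a fixed one of the two copies; on
  the right the edge is open in that copy with probability \<open>q\<close>.
\<close>

lemma splits_query:
  fixes p :: "'a set \<Rightarrow> real"
  assumes fin: "finite R" and e: "{x, y} \<notin> R"
    and p: "\<And>e. e \<in> insert {x, y} R \<Longrightarrow> 0 \<le> p e \<and> p e \<le> 1"
  shows "p {x, y} * prob_open2 p R (splits b c (y # x # xs))
      + (1 - p {x, y}) * prob_open2 p R (splits b c (x # xs))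
    \<le> prob_open2 p (insert {x, y} R) (splits b c (x # xs))"
proof -
  define e q where "e = {x, y}" and "q = p e"
  define d where "d F G = (of_bool (splits b c (x # xs) F G) :: real)" for F G
  define d1 where "d1 F G = (of_bool (splits b c (y # x # xs) F G) :: real)" for F G
  have q: "0 \<le> q" "q \<le> 1"
    using p by (auto simp: q_def e_def)
  have pointwise: "q * d1 F G + (1 - q) * d F G \<le>
      q * (q * d (insert e F) (insert e G) + (1 - q) * d (insert e F) G)
      + (1 - q) * (q * d F (insert e G) + (1 - q) * d F G)" for F G
  proof -
    have sub: "F \<subseteq> insert e F" "G \<subseteq> insert e G"
      by auto
    have mono: "d F G \<le> d (insert e F) G" "d F G \<le> d F (insert e G)"
      "d (insert e F) G \<le> d (insert e F) (insert e G)"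
      "d F (insert e G) \<le> d (insert e F) (insert e G)"
      unfolding d_def using splits_mono[OF _ sub(1) order_refl] splits_mono[OF _ order_refl sub(2)]
      by (auto simp: of_bool_def)
    have step: "d1 F G \<le> max (d (insert e F) G) (d F (insert e G))"
      unfolding d_def d1_def e_def using splits_contract_edge[of b c y x xs F G]
      by (auto simp: of_bool_def)
    have 01: "d F G \<in> {0,1}" "d1 F G \<in> {0,1}" "d (insert e F) G \<in> {0,1}"
      "d F (insert e G) \<in> {0,1}" "d (insert e F) (insert e G) \<in> {0,1}"
      by (auto simp: d_def d1_def)
    have "0 \<le> q * (1 - q)" using q by simp
    then show ?thesis
      using 01 mono step q by (auto simp: algebra_simps max_def split: if_splits)
  qed
  have "q * expect p R (\<lambda>F. expect p R (d1 F)) + (1 - q) * expect p R (\<lambda>F. expect p R (d F))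
    = expect p R (\<lambda>F. expect p R (\<lambda>G. q * d1 F G + (1 - q) * d F G))"
    by (simp add: expect_add expect_cmult)
  also have "\<dots> \<le> expect p R (\<lambda>F. expect p R (\<lambda>G.
      q * (q * d (insert e F) (insert e G) + (1 - q) * d (insert e F) G)
      + (1 - q) * (q * d F (insert e G) + (1 - q) * d F G)))"
    using p by (intro expect_mono pointwise) auto
  also have "\<dots> = expect p (insert e R) (\<lambda>F. expect p (insert e R) (d F))"
    using fin e unfolding e_def[symmetric]
    by (simp add: expect_insert expect_add expect_cmult q_def) (simp add: algebra_simps)
  finally show ?thesis
    by (simp add: d_def[abs_def] d1_def[abs_def] q_def e_def)
qed

text \<open>Here the tip of the walk is \<open>b\<close>, so that \<open>b\<close> is reached with certainty and the claim is
  \<open>q\<^sup>2 \<le> 2 w\<close>, where \<open>q\<close> is the probability of reaching \<open>c\<close> and \<open>w\<close> that of splitting. The square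
  is taken as the probability of reaching \<open>c\<close> in two independent copies, and the factor \<open>2\<close> counts
  which of them attaches \<open>c\<close> farther from the tip.\<close>

lemma exploration_at_target:
  assumes fin: "finite R" and p: "\<And>e. e \<in> R \<Longrightarrow> 0 \<le> p e \<and> p e \<le> 1"
  shows "prob_open p R (\<lambda>F. reaches (set (b # xs)) b F \<and> reaches (set (b # xs)) c F) \<le>
    sqrt (2 * prob_open p R (reaches (set (b # xs)) b) * prob_open2 p R (splits b c (b # xs)))"
proof -
  let ?q = "prob_open p R (reaches (set (b # xs)) c)"
  have b: "reaches (set (b # xs)) b F" for F
    unfolding reaches_def by (intro bexI[of _ b]) auto
  have "?q\<^sup>2 = expect p R (\<lambda>F. expect p R (\<lambda>G.
      of_bool (reaches (set (b # xs)) c F) * of_bool (reaches (set (b # xs)) c G)))"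
    by (simp add: expect_prod power2_eq_square)
  also have "\<dots> \<le> expect p R (\<lambda>F. expect p R (\<lambda>G.
      of_bool (splits b c (b # xs) F G) + of_bool (splits b c (b # xs) G F)))"
    using p splits_at_target[of b xs c] by (intro expect_mono) (auto simp: of_bool_def)
  also have "\<dots> = 2 * prob_open2 p R (splits b c (b # xs))"
    using expect_swap[of p R "\<lambda>F G. of_bool (splits b c (b # xs) F G)"]
    by (simp add: expect_add)
  finally have "?q \<le> sqrt (2 * prob_open2 p R (splits b c (b # xs)))"
    by (rule real_le_rsqrt)
  then show ?thesis
    using fin by (simp add: b[simplified] expect_const)
qed

text \<open>
  The invariant of the exploration with walk \<open>xs\<close> and unexplored edges \<open>R\<close>. The two summands
  account for the explorations that arrive first at \<open>b\<close> and first at \<open>c\<close>. In each of them the first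
  factor bounds the probability of this arrival, and twice the second one bounds the expected
  square of the conditional probability of reaching the third vertex after it. Crossing an edge lengthens the
  walk by one vertex and uses up one edge, so twice the number of edges plus the length of the walk
  decreases in every step.
\<close>

lemma exploration_inequality:
  fixes p :: "'a set \<Rightarrow> real"
  assumes "finite R" "\<And>e. e \<in> R \<Longrightarrow> card e = 2" "\<And>e. e \<in> R \<Longrightarrow> 0 \<le> p e \<and> p e \<le> 1"
  shows "prob_open p R (\<lambda>F. reaches (set xs) b F \<and> reaches (set xs) c F) \<le>
    sqrt (2 * prob_open p R (reaches (set xs) b) * prob_open2 p R (splits b c xs)) +
    sqrt (2 * prob_open p R (reaches (set xs) c) * prob_open2 p R (splits c b xs))"
  using assms
proof (induction "2 * card R + length xs" arbitrary: R xs rule: less_induct)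
  case less
  note fin = less.prems(1) and card2 = less.prems(2) and p = less.prems(3)
  have nonneg: "0 \<le> prob_open p S Q" "0 \<le> prob_open2 p S Q'" if "S \<subseteq> R" for S Q Q'
    using that p by (auto intro!: expect_nonneg)
  show ?case
  proof (cases xs)
    case Nil
    then have "prob_open p R (\<lambda>F. reaches (set xs) b F \<and> reaches (set xs) c F) = 0"
      using fin by (simp add: reaches_def expect_const)
    then show ?thesis
      using nonneg by simp
  next
    case (Cons x ws)
    consider "x = b" | "x = c" | "x \<noteq> b" "x \<noteq> c" "\<And>e. e \<in> R \<Longrightarrow> x \<notin> e"
      | e where "e \<in> R" "x \<in> e" by blast
    then show ?thesis
    proof cases
      case 1
      then show ?thesis
        using exploration_at_target[OF fin p, where b = b and c = c and xs = ws] Cons nonneg[OF order_refl]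
        by (simp add: add_increasing2)
    next
      case 2
      then show ?thesis
        using exploration_at_target[OF fin p, where b = c and c = b and xs = ws] Cons nonneg[OF order_refl]
        by (simp add: add_increasing conj_commute)
    next
      case 3
      (* The tip is exhausted: backtracking loses no connection. *)
      have pop: "reaches (set ws) v F" if "reaches (set xs) v F" "F \<subseteq> R" "v \<noteq> x" for v F
        using that 3(3) linked_isolated[of F x v] Cons unfolding reaches_def by auto
      have mono1: "prob_open p R (reaches (set ws) v) \<le> prob_open p R (reaches (set xs) v)" for v
        using p Cons by (intro expect_mono) (auto simp: of_bool_def reaches_def)
      have mono2: "prob_open2 p R (splits v w ws) \<le> prob_open2 p R (splits v w xs)" for v w
        using p Cons splits_Cons by (intro expect_mono) (auto simp: of_bool_def)
      have "prob_open p R (\<lambda>F. reaches (set xs) b F \<and> reaches (set xs) c F)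
          \<le> prob_open p R (\<lambda>F. reaches (set ws) b F \<and> reaches (set ws) c F)"
        using p pop 3 by (intro expect_mono) (auto simp: of_bool_def)
      also have "\<dots> \<le> sqrt (2 * prob_open p R (reaches (set ws) b) * prob_open2 p R (splits b c ws)) +
          sqrt (2 * prob_open p R (reaches (set ws) c) * prob_open2 p R (splits c b ws))"
        using Cons by (intro less.hyps fin card2 p) auto
      also have "\<dots> \<le> sqrt (2 * prob_open p R (reaches (set xs) b) * prob_open2 p R (splits b c xs)) +
          sqrt (2 * prob_open p R (reaches (set xs) c) * prob_open2 p R (splits c b xs))"
        using mono1 mono2 nonneg
        by (intro add_mono real_sqrt_le_mono mult_mono mult_left_mono) auto
      finally show ?thesis .
    next
      case (4 e)
      (* The edge e at the tip x is queried: the walk moves on to y if e is open and stays at x if not. *)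
      define S where "S = R - {e}"
      define q where "q = p e"
      have R: "R = insert e S" "e \<notin> S" "finite S" "S \<subseteq> R"
        using 4 fin by (auto simp: S_def)
      have q: "0 \<le> q" "q \<le> 1"
        using p 4 by (auto simp: q_def)
      obtain y where y: "e = {x, y}"
        using card2[OF 4(1)] 4(2) by (auto simp: card_2_iff)
      have smaller: "2 * card S + length (y # xs) < 2 * card R + length xs"
        "2 * card S + length xs < 2 * card R + length xs"
        using R by auto
      have S: "\<And>e. e \<in> S \<Longrightarrow> card e = 2" "\<And>e. e \<in> S \<Longrightarrow> 0 \<le> p e \<and> p e \<le> 1"
        using R card2 p by auto
      let ?A = "\<lambda>xs F. reaches (set xs) b F \<and> reaches (set xs) c F"
      let ?U = "\<lambda>T b xs. prob_open p T (reaches (set xs) b)"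
      let ?W = "\<lambda>T b c xs. prob_open2 p T (splits b c xs)"
      have A: "prob_open p R (?A xs) \<le> q * prob_open p S (?A (y # xs)) + (1 - q) * prob_open p S (?A xs)"
      proof -
        have "prob_open p S (\<lambda>F. ?A xs (insert e F)) \<le> prob_open p S (?A (y # xs))"
          using S(2) reaches_contract_edge[of "set xs" _ x y] Cons
          by (intro expect_mono) (auto simp: of_bool_def y)
        then show ?thesis
          using R q by (simp add: expect_insert q_def mult_left_mono)
      qed
      have U: "q * ?U S v (y # xs) + (1 - q) * ?U S v xs \<le> ?U R v xs" for v
      proof -
        have "?U S v (y # xs) \<le> prob_open p S (\<lambda>F. reaches (set xs) v (insert e F))"
          using S(2) reaches_insert_edge[of y "set xs" v _ x] Cons
          by (intro expect_mono) (auto simp: of_bool_def y)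
        then show ?thesis
          using R q by (simp add: expect_insert q_def mult_left_mono)
      qed
      have W: "q * ?W S v w (y # xs) + (1 - q) * ?W S v w xs \<le> ?W R v w xs" for v w
        using splits_query[of S x y p v w ws] R p unfolding Cons q_def y by simp
      have mix: "q * sqrt (2 * ?U S v (y # xs) * ?W S v w (y # xs)) + (1 - q) * sqrt (2 * ?U S v xs * ?W S v w xs)
        \<le> sqrt (2 * ?U R v xs * ?W R v w xs)" for v w
      proof -
        have "q * sqrt (2 * ?U S v (y # xs) * ?W S v w (y # xs)) + (1 - q) * sqrt (2 * ?U S v xs * ?W S v w xs)
          \<le> sqrt ((q * (2 * ?U S v (y # xs)) + (1 - q) * (2 * ?U S v xs))
                * (q * ?W S v w (y # xs) + (1 - q) * ?W S v w xs))"
          using q R(4) nonneg by (intro sqrt_mix_le) auto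
        also have "\<dots> \<le> sqrt (2 * ?U R v xs * ?W R v w xs)"
          using U[of v] W[of v w] q R(4) nonneg
          by (intro real_sqrt_le_mono mult_mono) auto
        finally show ?thesis .
      qed
      have "prob_open p R (?A xs) \<le>
          q * (sqrt (2 * ?U S b (y # xs) * ?W S b c (y # xs)) + sqrt (2 * ?U S c (y # xs) * ?W S c b (y # xs)))
          + (1 - q) * (sqrt (2 * ?U S b xs * ?W S b c xs) + sqrt (2 * ?U S c xs * ?W S c b xs))"
        using A less.hyps[OF smaller(1) R(3) S] less.hyps[OF smaller(2) R(3) S] q
        by (smt (verit) mult_left_mono)
      also have "\<dots> \<le> sqrt (2 * ?U R b xs * ?W R b c xs) + sqrt (2 * ?U R c xs * ?W R c b xs)"
        using mix[of b c] mix[of c b] unfolding distrib_left by linarith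
      finally show ?thesis .
    qed
  qed
qed

text \<open>For the walk that consists of \<open>a\<close> alone, splitting means that \<open>a\<close> is connected to one target in \<open>F\<close>
  and the targets are connected to each other in \<open>G\<close>; independence turns its probability into a
  product, and the two summands of the exploration inequality become equal.\<close>

lemma finite_three_point_inequality:
  fixes p :: "'a set \<Rightarrow> real"
  assumes "finite R" "\<And>e. e \<in> R \<Longrightarrow> card e = 2" "\<And>e. e \<in> R \<Longrightarrow> 0 \<le> p e \<and> p e \<le> 1"
  shows "(prob_open p R (\<lambda>F. linked F a b \<and> linked F a c))\<^sup>2 \<le>
    8 * prob_open p R (\<lambda>F. linked F a b) * prob_open p R (\<lambda>F. linked F a c)
      * prob_open p R (\<lambda>F. linked F b c)"
proof -
  let ?P = "\<lambda>u v. prob_open p R (\<lambda>F. linked F u v)"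
  have nonneg: "0 \<le> prob_open p R Q" for Q
    using assms(3) by (intro expect_nonneg) auto
  have reaches: "reaches (set [a]) v = (\<lambda>F. linked F a v)" for v
    by (auto simp: reaches_def)
  have splits: "splits v w [a] F G \<longleftrightarrow> linked F a w \<and> linked G v w" for v w F G
  proof -
    have "splits v w [a] F G \<longleftrightarrow> linked F a w \<and> (linked G v w \<or> linked G a v \<and> linked G a w)"
      by (auto simp: splits_def reaches_def Cons_eq_append_conv)
    then show ?thesis
      by (meson linked_sym linked_trans)
  qed
  have W: "prob_open2 p R (splits v w [a]) = ?P a w * ?P v w" for v w
    unfolding splits of_bool_conj by (rule expect_prod)
  have "linked F c b \<longleftrightarrow> linked F b c" for F
    by (blast intro: linked_sym)
  then have "?P c b = ?P b c"
    by simp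
  with exploration_inequality[where p = p and R = R, OF assms, where xs = "[a]" and b = b and c = c]
  have "prob_open p R (\<lambda>F. linked F a b \<and> linked F a c) \<le> 2 * sqrt (2 * ?P a b * ?P a c * ?P b c)"
    unfolding W reaches by (simp add: mult_ac)
  then have "(prob_open p R (\<lambda>F. linked F a b \<and> linked F a c))\<^sup>2 \<le> (2 * sqrt (2 * ?P a b * ?P a c * ?P b c))\<^sup>2"
    using nonneg by (intro power_mono) auto
  also have "\<dots> = 8 * ?P a b * ?P a c * ?P b c"
    using nonneg by (simp add: power_mult_distrib)
  finally show ?thesis .
qed

section \<open>Passage to infinite graphs\<close>

text \<open>The vertices within any given distance of a fixed vertex are finite in number.\<close>

lemma countable_edges:
  assumes "simple_graph V E" "locally_finite_graph V E" "connected_graph V E"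
  shows "countable E"
proof (cases "V = {}")
  case True
  then show ?thesis
    using assms(1) by (cases "E = {}") (auto simp: simple_graph_def)
next
  case False
  then obtain a where a: "a \<in> V" by auto
  let ?r = "{(x, y). {x, y} \<in> E}"
  have nb: "finite (?r `` {x})" for x
  proof (cases "x \<in> V")
    case True
    have "?r `` {x} \<subseteq> \<Union>{e \<in> E. x \<in> e}"
      by auto
    moreover have "finite (\<Union>{e \<in> E. x \<in> e})"
      using True assms(1,2)
      by (intro finite_Union) (auto simp: locally_finite_graph_def simple_graph_def intro: card_ge_0_finite)
    ultimately show ?thesis by (rule finite_subset)
  next
    case False
    then have "?r `` {x} = {}"
      using assms(1) by (auto simp: simple_graph_def)
    then show ?thesis by simp
  qed
  have "countable (?r `` Y)" if "countable Y" for Y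
    using that nb by (subst Image_eq_UN) (auto intro: countable_finite)
  then have "countable (?r\<^sup>* `` {a})"
    by (intro countable_rtrancl) auto
  moreover have "V \<subseteq> ?r\<^sup>* `` {a}"
    using assms(3) a by (auto simp: connected_graph_def joined_def)
  ultimately have "countable V"
    by (rule countable_subset[rotated])
  moreover have "E \<subseteq> (\<Union>v\<in>V. {e \<in> E. v \<in> e})"
  proof
    fix e assume "e \<in> E"
    then have "e \<subseteq> V" "e \<noteq> {}"
      using assms(1) by (auto simp: simple_graph_def)
    with \<open>e \<in> E\<close> show "e \<in> (\<Union>v\<in>V. {e \<in> E. v \<in> e})" by auto
  qed
  ultimately show ?thesis
    using assms(2) by (elim countable_subset)
      (auto simp: locally_finite_graph_def intro: countable_finite)
qed

lemma prob_space_percolation: "prob_space (percolation E p)"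
  unfolding percolation_def by (intro prob_space_PiM measure_pmf.prob_space_axioms)

text \<open>An event that depends on finitely many edges is a finite disjoint union of cylinders, one for
  each set of open edges among them.\<close>

lemma percolation_finite_event:
  assumes "finite D" "D \<subseteq> E" "\<And>e. e \<in> E \<Longrightarrow> 0 \<le> p e \<and> p e \<le> 1"
  shows "{\<omega> \<in> space (percolation E p). Q {e \<in> D. \<omega> e}} \<in> sets (percolation E p)"
    and "\<P>(\<omega> in percolation E p. Q {e \<in> D. \<omega> e}) = prob_open p D Q"
proof -
  let ?M = "percolation E p"
  interpret product_prob_space "\<lambda>e. measure_pmf (bernoulli_pmf (p e))" E
    by unfold_locales
  define cyl where "cyl F = prod_emb E (\<lambda>e. measure_pmf (bernoulli_pmf (p e))) D (\<Pi>\<^sub>E e\<in>D. {e \<in> F})" for F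
  have cyl: "cyl F = {\<omega> \<in> space ?M. {e \<in> D. \<omega> e} = F}" if "F \<subseteq> D" for F
    using that assms(2)
    by (auto simp: cyl_def prod_emb_def percolation_def space_PiM restrict_def PiE_iff extensional_def subset_iff)
  have sets: "cyl F \<in> sets ?M" for F
    unfolding cyl_def percolation_def using assms by (intro sets_PiM_I) auto
  have meas: "measure ?M (cyl F) = (\<Prod>e\<in>F. p e) * (\<Prod>e\<in>D - F. 1 - p e)" if "F \<subseteq> D" for F
  proof -
    have "measure ?M (cyl F) = (\<Prod>e\<in>D. measure (measure_pmf (bernoulli_pmf (p e))) {e \<in> F})"
      unfolding cyl_def percolation_def using assms(1,2) by (intro measure_PiM_emb) auto
    also have "\<dots> = (\<Prod>e\<in>D. if e \<in> F then p e else 1 - p e)"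
      using assms(2,3) by (intro prod.cong) (auto simp: measure_pmf_single)
    also have "\<dots> = (\<Prod>e\<in>F. p e) * (\<Prod>e\<in>D - F. 1 - p e)"
      using that assms(1) by (simp add: prod.If_cases Int_absorb1 Diff_eq)
    finally show ?thesis .
  qed
  have ev: "{\<omega> \<in> space ?M. Q {e \<in> D. \<omega> e}} = (\<Union>F\<in>{F \<in> Pow D. Q F}. cyl F)"
    by (auto simp: cyl)
  have fin: "finite {F \<in> Pow D. Q F}"
    using assms(1) by simp
  show "{\<omega> \<in> space ?M. Q {e \<in> D. \<omega> e}} \<in> sets ?M"
    unfolding ev using fin sets by (intro sets.finite_UN) auto
  interpret perc: prob_space ?M
    by (rule prob_space_percolation)
  have "measure ?M (\<Union>F\<in>{F \<in> Pow D. Q F}. cyl F) = (\<Sum>F\<in>{F \<in> Pow D. Q F}. measure ?M (cyl F))"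
  proof (intro perc.finite_measure_finite_Union fin)
    show "disjoint_family_on cyl {F \<in> Pow D. Q F}"
      by (auto simp: disjoint_family_on_def cyl)
  qed (use sets in auto)
  also have "\<dots> = (\<Sum>F\<in>{F \<in> Pow D. Q F}. (\<Prod>e\<in>F. p e) * (\<Prod>e\<in>D - F. 1 - p e))"
    by (intro sum.cong) (auto simp: meas)
  also have "\<dots> = prob_open p D Q"
    unfolding expect_def using assms(1)
    by (intro sum.mono_neutral_cong_left) auto
  finally show "\<P>(\<omega> in ?M. Q {e \<in> D. \<omega> e}) = prob_open p D Q"
    unfolding ev .
qed

text \<open>Increasing events with finite witnesses are increasing unions of their restrictions to the finite
  edge sets \<open>D n\<close>, so continuity of measure from below applies.\<close>

lemma percolation_exhaustion:
  assumes D: "incseq D" "\<And>n. finite (D n)" "(\<Union>n. D n) = E"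
    and p: "\<And>e. e \<in> E \<Longrightarrow> 0 \<le> p e \<and> p e \<le> 1"
    and mono: "\<And>F G. Q F \<Longrightarrow> F \<subseteq> G \<Longrightarrow> Q G"
    and witness: "\<And>F. Q F \<Longrightarrow> \<exists>K. finite K \<and> K \<subseteq> F \<and> Q K"
  shows "(\<lambda>n. prob_open p (D n) Q) \<longlonglongrightarrow> \<P>(\<omega> in percolation E p. Q {e \<in> E. \<omega> e})"
proof -
  interpret P: prob_space "percolation E p"
    by (rule prob_space_percolation)
  let ?A = "\<lambda>n. {\<omega> \<in> space (percolation E p). Q {e \<in> D n. \<omega> e}}"
  have DE: "D n \<subseteq> E" for n
    using D(3) by auto
  have "incseq ?A"
  proof (rule monoI)
    fix m n :: nat assume "m \<le> n"
    then have "{e \<in> D m. \<omega> e} \<subseteq> {e \<in> D n. \<omega> e}" for \<omega>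
      using D(1) by (auto dest: incseqD)
    then show "?A m \<le> ?A n"
      using mono by blast
  qed
  then have "(\<lambda>n. measure (percolation E p) (?A n)) \<longlonglongrightarrow> measure (percolation E p) (\<Union>n. ?A n)"
    using percolation_finite_event(1)[where E = E and p = p, OF D(2) DE p] by (intro P.finite_Lim_measure_incseq) auto
  moreover have "(\<Union>n. ?A n) = {\<omega> \<in> space (percolation E p). Q {e \<in> E. \<omega> e}}"
  proof (intro equalityI subsetI)
    fix \<omega> assume "\<omega> \<in> {\<omega> \<in> space (percolation E p). Q {e \<in> E. \<omega> e}}"
    then obtain K where K: "finite K" "K \<subseteq> {e \<in> E. \<omega> e}" "Q K" and \<omega>: "\<omega> \<in> space (percolation E p)"
      using witness by blast
    obtain n where "K \<subseteq> D n"
    proof (rule finite_subset_Union_chain[of K "range D" UNIV])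
      show "subset.chain UNIV (range D)"
        using D(1) unfolding subset_chain_def incseq_def by (metis UNIV_I nle_le rangeE subsetI)
    qed (use K(1,2) D(3) in auto)
    then have "Q {e \<in> D n. \<omega> e}"
      using K by (intro mono[OF K(3)]) auto
    with \<omega> show "\<omega> \<in> (\<Union>n. ?A n)" by auto
  next
    fix \<omega> assume "\<omega> \<in> (\<Union>n. ?A n)"
    then obtain n where "Q {e \<in> D n. \<omega> e}" "\<omega> \<in> space (percolation E p)" by auto
    moreover have "{e \<in> D n. \<omega> e} \<subseteq> {e \<in> E. \<omega> e}"
      using DE by auto
    ultimately show "\<omega> \<in> {\<omega> \<in> space (percolation E p). Q {e \<in> E. \<omega> e}}"
      using mono by blast
  qed
  ultimately show ?thesis
    using percolation_finite_event(2)[where E = E and p = p, OF D(2) DE p] by simp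
qed

lemma same_cluster_iff:
  assumes "x \<in> V" "S \<subseteq> V"
  shows "(\<exists>C\<in>clusters V E \<omega>. insert x S \<subseteq> C) \<longleftrightarrow> (\<forall>v\<in>S. linked {e \<in> E. \<omega> e} x v)"
proof -
  have joined: "(u, v) \<in> joined V F \<longleftrightarrow> u \<in> V \<and> v \<in> V \<and> linked F u v" for F u v
    by (simp add: joined_def linked_def)
  let ?F = "{e \<in> E. \<omega> e}"
  show ?thesis
  proof
    assume "\<exists>C\<in>clusters V E \<omega>. insert x S \<subseteq> C"
    then obtain u where "\<forall>v\<in>insert x S. linked ?F u v"
      by (auto simp: clusters_def connected_components_def quotient_def joined subset_iff)
    then show "\<forall>v\<in>S. linked ?F x v"
      by (meson insertCI linked_sym linked_trans)
  next
    assume "\<forall>v\<in>S. linked ?F x v"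
    then have "insert x S \<subseteq> joined V ?F `` {x}"
      using assms by (auto simp: joined)
    then show "\<exists>C\<in>clusters V E \<omega>. insert x S \<subseteq> C"
      using assms(1) unfolding clusters_def connected_components_def by (blast intro: quotientI)
  qed
qed

theorem theorem1p1:
  fixes V :: "'a set" and E :: "'a set set" and p :: "'a set \<Rightarrow> real" and a b c :: 'a
  assumes "simple_graph V E"
    and "locally_finite_graph V E"
    and "connected_graph V E"
    and "\<And>e. e \<in> E \<Longrightarrow> 0 \<le> p e \<and> p e \<le> 1"
    and "a \<in> V" "b \<in> V" "c \<in> V"
    and "a \<noteq> b" "a \<noteq> c" "b \<noteq> c"
  shows "(same_cluster_prob V E p {a, b, c})\<^sup>2 \<le>
    8 * same_cluster_prob V E p {a, b} * same_cluster_prob V E p {a, c} *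
      same_cluster_prob V E p {b, c}"
proof -
  obtain D where D: "incseq D" "\<And>n. finite (D n)" "(\<Union>n. D n) = E"
  proof -
    have "countable E"
      using assms(1-3) by (rule countable_edges)
    let ?D = "\<lambda>n. {e \<in> E. to_nat_on E e < n}"
    have "finite (?D n)" for n
    proof -
      have "?D n = to_nat_on E -` {..<n} \<inter> E"
        by auto
      then show ?thesis
        using inj_on_to_nat_on[OF \<open>countable E\<close>] by (simp add: finite_vimage_IntI)
    qed
    then show ?thesis
      by (intro that[of ?D]) (auto simp: incseq_def)
  qed
  have two: "(\<lambda>n. prob_open p (D n) (\<lambda>F. linked F u v)) \<longlonglongrightarrow> same_cluster_prob V E p {u, v}"
    if "u \<in> V" "v \<in> V" for u v
  proof -
    have "(\<lambda>n. prob_open p (D n) (\<lambda>F. linked F u v))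
        \<longlonglongrightarrow> \<P>(\<omega> in percolation E p. linked {e \<in> E. \<omega> e} u v)"
      by (rule percolation_exhaustion[where p = p and Q = "\<lambda>F. linked F u v", OF D assms(4)])
        (auto intro: linked_mono linked_finite_subset)
    moreover have "(\<exists>C\<in>clusters V E \<omega>. {u, v} \<subseteq> C) \<longleftrightarrow> linked {e \<in> E. \<omega> e} u v" for \<omega>
      using same_cluster_iff[of u V "{v}" E \<omega>] that by simp
    ultimately show ?thesis
      by (simp only: same_cluster_prob_def)
  qed
  have three: "(\<lambda>n. prob_open p (D n) (\<lambda>F. linked F a b \<and> linked F a c))
      \<longlonglongrightarrow> same_cluster_prob V E p {a, b, c}"
  proof -
    have witness: "\<exists>K. finite K \<and> K \<subseteq> F \<and> linked K a b \<and> linked K a c" if ab: "linked F a b" and ac: "linked F a c" for F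
    proof -
      obtain K L where "finite K" "K \<subseteq> F" "linked K a b" "finite L" "L \<subseteq> F" "linked L a c"
        using linked_finite_subset[OF ab] linked_finite_subset[OF ac] by blast
      then show ?thesis
        by (intro exI[of _ "K \<union> L"]) (auto elim: linked_mono)
    qed
    have "(\<lambda>n. prob_open p (D n) (\<lambda>F. linked F a b \<and> linked F a c))
        \<longlonglongrightarrow> \<P>(\<omega> in percolation E p. linked {e \<in> E. \<omega> e} a b \<and> linked {e \<in> E. \<omega> e} a c)"
      by (rule percolation_exhaustion[where p = p and Q = "\<lambda>F. linked F a b \<and> linked F a c",
            OF D assms(4)])
        (auto intro: linked_mono witness)
    moreover have "(\<exists>C\<in>clusters V E \<omega>. {a, b, c} \<subseteq> C)
        \<longleftrightarrow> linked {e \<in> E. \<omega> e} a b \<and> linked {e \<in> E. \<omega> e} a c" for \<omega>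
      using same_cluster_iff[of a V "{b, c}" E \<omega>] assms(5-7) by simp
    ultimately show ?thesis
      by (simp only: same_cluster_prob_def)
  qed
  show ?thesis
  proof (rule LIMSEQ_le)
    show "\<exists>N. \<forall>n\<ge>N. (prob_open p (D n) (\<lambda>F. linked F a b \<and> linked F a c))\<^sup>2 \<le>
      8 * prob_open p (D n) (\<lambda>F. linked F a b) * prob_open p (D n) (\<lambda>F. linked F a c)
        * prob_open p (D n) (\<lambda>F. linked F b c)"
    proof (intro exI[of _ 0] allI impI finite_three_point_inequality D(2))
      fix n e assume "e \<in> D n"
      then have "e \<in> E"
        using D(3) by auto
      then show "card e = 2" "0 \<le> p e \<and> p e \<le> 1"
        using assms(1,4) by (auto simp: simple_graph_def)
    qed
    show "(\<lambda>n. (prob_open p (D n) (\<lambda>F. linked F a b \<and> linked F a c))\<^sup>2)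
        \<longlonglongrightarrow> (same_cluster_prob V E p {a, b, c})\<^sup>2"
      by (rule tendsto_power[OF three])
    show "(\<lambda>n. 8 * prob_open p (D n) (\<lambda>F. linked F a b) * prob_open p (D n) (\<lambda>F. linked F a c)
          * prob_open p (D n) (\<lambda>F. linked F b c))
        \<longlonglongrightarrow> 8 * same_cluster_prob V E p {a, b} * same_cluster_prob V E p {a, c}
          * same_cluster_prob V E p {b, c}"
      by (rule tendsto_mult[OF tendsto_mult[OF tendsto_mult[OF tendsto_const two] two] two])
        (rule assms(5-7))+
  qed
qed

end
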